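(* Let $f:\mathbb{F}_2^n\to\mathbb{F}_2^n$ be a Boolean monomial system whose dependency graph $\mathcal{X}$ is strongly connected with loop number $t\ge 1$. Then: (1) $f$ has fixed points $(0,\ldots,0)$ and $(1,\ldots,1)$. (2) $f$ has limit cycles of all lengths dividing $t$. (3) $f$ is a fixed point system if and only if the loop number of $\mathcal{X}$ is $1$.
   Context: A Boolean monomial system is a map $f=(f_1,\ldots,f_n):\mathbb{F}_2^n\to\mathbb{F}_2^n$ where each $f_i=\alpha_i x_1^{\varepsilon_{1i}}\cdots x_n^{\varepsilon_{ni}}$ with $\alpha_i,\varepsilon_{ji}\in\{0,1\}$ (all $\varepsilon_{ji}=0$ if $\alpha_i=0$); so each $f_i$ is $0$, $1$, or a product of distinct variables. The state space of $f$ is the digraph on $\mathbb{F}_2^n$ with an edge $u\to v$ iff $f(u)=v$; its directed cycles are the limit cycles of $f$ (a fixed point is a limit cycle of length $1$). $f$ is a fixed point system if all its limit cycles are fixed points. The dependency graph $\mathcal{X}$ of $f$ is the digraph with vertex set $\{a_1,\ldots,a_n,\varepsilon\}$, with an edge $a_i\to a_j$ iff $\alpha_i=1$ and $\varepsilon_{ji}=1$, and an edge $a_i\to\varepsilon$ iff $f_i=0$. Write $a\in\mathcal{X}$ for a vertex $a\ne\varepsilon$. A walk is a directed walk (repetitions allowed), $|p|$ is its length, and the empty walk has length $0$. $\mathcal{X}$ is strongly connected if for all $a,b\in\mathcal{X}$ there is a walk from $a$ to $b$. The loop number of $a\in\mathcal{X}$ is the minimum of all $t\ge 1$ such that $t=|p|-|q|$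 for closed walks $p,q:a\to a$; it is $0$ if there is no closed walk of positive length at $a$. On a strongly connected $\mathcal{X}$ it is the same for all vertices and is called the loop number of $\mathcal{X}$. *)

theory Defs
  imports
    "HOL-Analysis.Finite_Cartesian_Product"
    "HOL-Library.Z2"
    "Graph_Theory.Graph_Theory"
begin

section \<open>Boolean monomial systems\<close>

text \<open>
  Vectors over the two-element field are \<open>bit ^ 'n\<close>, with \<open>CARD('n)\<close> in the role of \<open>n\<close>.
  As in the usual notation \<open>\<epsilon>\<^sub>j\<^sub>i\<close>, the exponent of \<open>x\<^sub>j\<close> in \<open>f\<^sub>i\<close> is \<open>e j i\<close>;
  by \<open>0 ^ 0 = 1\<close> a variable with exponent \<open>0\<close> does not occur.
\<close>

definition monomial_map ::
    "('n \<Rightarrow> bit) \<Rightarrow> ('n \<Rightarrow> 'n \<Rightarrow> nat) \<Rightarrow> bit ^ 'n \<Rightarrow> bit ^ ('n :: finite)" where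
  "monomial_map \<alpha> e x = (\<chi> i. \<alpha> i * (\<Prod>j\<in>UNIV. (x $ j) ^ e j i))"

definition boolean_monomial_system ::
    "(bit ^ 'n \<Rightarrow> bit ^ 'n) \<Rightarrow> ('n \<Rightarrow> bit) \<Rightarrow> ('n \<Rightarrow> 'n \<Rightarrow> nat) \<Rightarrow> bool" where
  "boolean_monomial_system f \<alpha> e \<longleftrightarrow>
     (\<forall>j i. e j i \<in> {0, 1}) \<and>
     (\<forall>i. \<alpha> i = 0 \<longrightarrow> (\<forall>j. e j i = 0)) \<and>
     f = monomial_map \<alpha> e"

definition state_space ::
    "(bit ^ 'n \<Rightarrow> bit ^ 'n) \<Rightarrow> (bit ^ 'n, (bit ^ 'n) \<times> (bit ^ 'n)) pre_digraph" where
  "state_space f = \<lparr>verts = UNIV, arcs = {(u, v). f u = v}, tail = fst, head = snd\<rparr>"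

text \<open>The library's cycles are nonempty and may be loops, so fixed points are included.\<close>

definition limit_cycle ::
    "(bit ^ 'n \<Rightarrow> bit ^ 'n) \<Rightarrow> ((bit ^ 'n) \<times> (bit ^ 'n)) awalk \<Rightarrow> bool" where
  "limit_cycle f c \<longleftrightarrow> pre_digraph.cycle (state_space f) c"

definition fixed_point_system :: "(bit ^ 'n \<Rightarrow> bit ^ 'n) \<Rightarrow> bool" where
  "fixed_point_system f \<longleftrightarrow> (\<forall>c. limit_cycle f c \<longrightarrow> length c = 1)"

section \<open>The dependency graph\<close>

text \<open>\<open>Var i\<close> is the vertex \<open>a\<^sub>i\<close>; \<open>Eps\<close> is the additional vertex \<open>\<epsilon>\<close>.\<close>

datatype 'n dep_vertex = Var 'n | Eps

definition dependency_graph ::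
    "('n :: finite \<Rightarrow> bit) \<Rightarrow> ('n \<Rightarrow> 'n \<Rightarrow> nat)
      \<Rightarrow> ('n dep_vertex, 'n dep_vertex \<times> 'n dep_vertex) pre_digraph" where
  "dependency_graph \<alpha> e =
     \<lparr>verts = UNIV,
      arcs = {(Var i, Var j) | i j. \<alpha> i = 1 \<and> e j i = 1}
           \<union> {(Var i, Eps) | i. \<forall>x. monomial_map \<alpha> e x $ i = 0},
      tail = fst, head = snd\<rparr>"

text \<open>
  The vertex \<open>\<epsilon>\<close> is exempt from strong connectedness, so this is not the library's
  \<open>strongly_connected\<close>.
\<close>

definition dep_strongly_connected :: "('n dep_vertex, 'b) pre_digraph \<Rightarrow> bool" where
  "dep_strongly_connected X \<longleftrightarrow> (\<forall>i j. \<exists>p. pre_digraph.awalk X (Var i) p (Var j))"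

definition vertex_loop_number :: "('a, 'b) pre_digraph \<Rightarrow> 'a \<Rightarrow> nat" where
  "vertex_loop_number X a =
     (if \<exists>p. pre_digraph.awalk X a p a \<and> length p > 0
      then LEAST t. t \<ge> 1 \<and> (\<exists>p q. pre_digraph.awalk X a p a \<and> pre_digraph.awalk X a q a
                                   \<and> int t = int (length p) - int (length q))
      else 0)"

text \<open>
  The common loop number of the vertices other than \<open>\<epsilon>\<close>, which exists if the graph is
  strongly connected; otherwise the value may be unspecified.
\<close>

definition loop_number :: "('n dep_vertex, 'b) pre_digraph \<Rightarrow> nat" where
  "loop_number X = (THE t. \<forall>i. vertex_loop_number X (Var i) = t)"

end

theory Submission
  imports Defs
begin

text \<open>
  If \<open>t\<close> is the loop number, the length of a walk between two given vertices is determined modulo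
  \<open>t\<close>, so for \<open>d\<close> dividing \<open>t\<close> the vertices fall into \<open>d\<close> classes that every edge permutes
  cyclically; the indicator vectors of these classes form a limit cycle of length \<open>d\<close>. If \<open>t = 1\<close>,
  there are walks of every sufficiently large length between any two vertices, so a zero in a
  periodic state spreads to all coordinates and the state is constant.
\<close>

section \<open>Closed walks of a strongly connected relation\<close>

lemma relpow_mult_refl:
  assumes "(a, a) \<in> R ^^ m"
  shows "(a, a) \<in> R ^^ (k * m)"
  using assms by (induction k) (auto simp: relpow_add)

lemma relpow_relpow_add:
  assumes "(a, b) \<in> R ^^ m" "(b, c) \<in> R ^^ n"
  shows "(a, c) \<in> R ^^ (m + n)"
  using assms by (auto simp: relpow_add)

text \<open>The least positive \<open>t\<close> of this kind is the loop number of \<open>a\<close>,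
  provided that a closed walk of positive length exists. The difference is taken in the integers,
  since truncated subtraction would lose the order of \<open>m\<close> and \<open>n\<close>.\<close>

definition closed_diff :: "('a \<times> 'a) set \<Rightarrow> 'a \<Rightarrow> nat \<Rightarrow> bool" where
  "closed_diff R a t \<longleftrightarrow>
     (\<exists>m n. (a, a) \<in> R ^^ m \<and> (a, a) \<in> R ^^ n \<and> int t = int m - int n)"

text \<open>Both closed walks at \<open>a\<close> are extended by the same walks from
  \<open>b\<close> to \<open>a\<close> and back, which changes their lengths equally and leaves the
  difference alone.\<close>

lemma closed_diff_transfer:
  assumes "(a, b) \<in> R\<^sup>*" "(b, a) \<in> R\<^sup>*" "closed_diff R a t"
  shows "closed_diff R b t"
proof -
  obtain k l where kl: "(a, b) \<in> R ^^ k" "(b, a) \<in> R ^^ l"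
    using assms(1,2) by (auto simp: rtrancl_power)
  obtain m n where mn: "(a, a) \<in> R ^^ m" "(a, a) \<in> R ^^ n" "int t = int m - int n"
    using assms(3) by (auto simp: closed_diff_def)
  have "(b, b) \<in> R ^^ (l + (m + k))" "(b, b) \<in> R ^^ (l + (n + k))"
    using kl mn by (blast intro: relpow_relpow_add)+
  moreover have "int t = int (l + (m + k)) - int (l + (n + k))"
    using mn(3) by simp
  ultimately show ?thesis unfolding closed_diff_def by blast
qed

lemma positive_closed_transfer:
  assumes "(a, b) \<in> R\<^sup>*" "(b, a) \<in> R\<^sup>*" "\<exists>m>0. (a, a) \<in> R ^^ m"
  shows "\<exists>m>0. (b, b) \<in> R ^^ m"
proof -
  obtain k l where kl: "(a, b) \<in> R ^^ k" "(b, a) \<in> R ^^ l"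
    using assms(1,2) by (auto simp: rtrancl_power)
  obtain m where m: "m > 0" "(a, a) \<in> R ^^ m"
    using assms(3) by blast
  have "(b, b) \<in> R ^^ (l + (m + k))"
    using kl m by (blast intro: relpow_relpow_add)
  then show ?thesis using m(1) by (intro exI[of _ "l + (m + k)"]) auto
qed

text \<open>Division with remainder: a nonzero remainder \<open>m mod t\<close> would itself be a
  difference of closed walk lengths, and smaller than the least one.\<close>

lemma least_closed_diff_dvd:
  assumes t: "closed_diff R a t" "t \<ge> 1"
    and least: "\<And>s. closed_diff R a s \<Longrightarrow> s \<ge> 1 \<Longrightarrow> t \<le> s"
    and m: "(a, a) \<in> R ^^ m"
  shows "t dvd m"
proof (rule ccontr)
  assume "\<not> t dvd m"
  then have "m mod t \<ge> 1" by (simp add: dvd_eq_mod_eq_0)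
  obtain p q where pq: "(a, a) \<in> R ^^ p" "(a, a) \<in> R ^^ q" "int t = int p - int q"
    using t(1) by (auto simp: closed_diff_def)
  \<comment> \<open>Since \<open>t = p - q\<close>, the remainder is
    \<open>m - (m div t) * (p - q)\<close>; collecting the positive and the negative terms yields
    lengths of two actual walks.\<close>
  have "(a, a) \<in> R ^^ (m + (m div t) * q)" "(a, a) \<in> R ^^ ((m div t) * p)"
    using m pq by (blast intro: relpow_relpow_add relpow_mult_refl)+
  moreover have "int (m mod t) = int (m + (m div t) * q) - int ((m div t) * p)"
  proof -
    have "int m = int (m div t) * int t + int (m mod t)"
      by (metis div_mult_mod_eq of_nat_add of_nat_mult)
    then show ?thesis using pq(3) by (simp add: algebra_simps)
  qed
  ultimately have "closed_diff R a (m mod t)" unfolding closed_diff_def by blast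
  then have "t \<le> m mod t" using least \<open>m mod t \<ge> 1\<close> by blast
  then show False using t(2) mod_less_divisor[of t m] by linarith
qed

text \<open>One return walk from \<open>b\<close> to \<open>a\<close> closes both walks, and the two
  resulting lengths are multiples of \<open>t\<close>.\<close>

lemma walk_length_cong:
  assumes conn: "\<And>x y. (x, y) \<in> R\<^sup>*"
    and dvd: "\<And>m. (a, a) \<in> R ^^ m \<Longrightarrow> t dvd m"
    and m: "(a, b) \<in> R ^^ m" and n: "(a, b) \<in> R ^^ n"
  shows "m mod t = n mod t"
proof -
  obtain k where k: "(b, a) \<in> R ^^ k"
    using conn by (auto simp: rtrancl_power)
  have "t dvd m + k" "t dvd n + k"
    using dvd[OF relpow_relpow_add[OF m k]] dvd[OF relpow_relpow_add[OF n k]] by simp_all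
  then have "int t dvd int (m + k) - int (n + k)"
    by (metis dvd_diff int_dvd_int_iff)
  then have "int m mod int t = int n mod int t"
    by (simp add: mod_eq_dvd_iff)
  then show ?thesis by (metis of_nat_eq_iff zmod_int)
qed

text \<open>There are closed walks of the consecutive lengths \<open>q\<close> and
  \<open>q + 1\<close>, and every number from \<open>q * q\<close> on is a sum of copies of these
  two.\<close>

lemma all_large_closed_walks:
  assumes "closed_diff R a 1"
  obtains N where "\<And>n. n \<ge> N \<Longrightarrow> (a, a) \<in> R ^^ n"
proof -
  obtain p q where "(a, a) \<in> R ^^ p" and q: "(a, a) \<in> R ^^ q" and pq: "int 1 = int p - int q"
    using assms by (auto simp: closed_diff_def)
  then have p: "(a, a) \<in> R ^^ Suc q"
    by (metis add.commute diff_eq_eq int_ops(2) of_nat_Suc of_nat_eq_iff)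
  have "(a, a) \<in> R ^^ n" if n: "n \<ge> q * q" for n
  proof (cases "q = 0")
    \<comment> \<open>Here \<open>Suc q = 1\<close>, so there is a loop at \<open>a\<close>, which
      can be repeated \<open>n\<close> times.\<close>
    case True
    then show ?thesis using relpow_mult_refl[OF p, of n] by simp
  next
    case False
    have "q \<le> n div q"
      using n False by (simp add: less_eq_div_iff_mult_less_eq)
    then have "n mod q \<le> n div q"
      using False mod_less_divisor[of q n] by linarith
    \<comment> \<open>In \<open>n = (n div q) * q + n mod q\<close> the remainder is absorbed by
      lengthening \<open>n mod q\<close> of the \<open>n div q\<close> walks by one each.\<close>
    then have "(n div q - n mod q) * q + (n mod q) * Suc q = (n div q - n mod q + n mod q) * q + n mod q"
      by (simp only: add_mult_distrib mult_Suc_right add.assoc add.commute)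
    also have "\<dots> = n"
      using \<open>n mod q \<le> n div q\<close> by simp
    finally have "n = (n div q - n mod q) * q + (n mod q) * Suc q" ..
    moreover have "(a, a) \<in> R ^^ ((n div q - n mod q) * q + (n mod q) * Suc q)"
      using p q by (blast intro: relpow_relpow_add relpow_mult_refl)
    ultimately show ?thesis by metis
  qed
  then show ?thesis using that by blast
qed

section \<open>Walks in the dependency graph\<close>

definition dep_rel :: "('n \<Rightarrow> bit) \<Rightarrow> ('n \<Rightarrow> 'n \<Rightarrow> nat) \<Rightarrow> ('n \<times> 'n) set" where
  "dep_rel \<alpha> e = {(i, j). \<alpha> i = 1 \<and> e j i = 1}"

lemma dep_awalk_imp_relpow:
  assumes "pre_digraph.awalk (dependency_graph \<alpha> e) (Var i) p (Var j)"
  shows "(i, j) \<in> dep_rel \<alpha> e ^^ length p"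
  using assms
proof (induction p arbitrary: i)
  case Nil
  then show ?case by (simp add: pre_digraph.awalk_def pre_digraph.cas.simps)
next
  case (Cons a p)
  note aw = Cons.prems[unfolded pre_digraph.awalk_def pre_digraph.cas.simps]
  have cas: "pre_digraph.cas (dependency_graph \<alpha> e) (snd a) p (Var j)"
    using aw by (simp add: dependency_graph_def)
  \<comment> \<open>No arc leaves \<open>Eps\<close>, so a walk that enters it cannot end in
    \<open>Var j\<close>.\<close>
  have "snd a \<noteq> Eps"
  proof
    assume "snd a = Eps"
    with cas aw show False
      by (cases p) (auto simp: pre_digraph.cas.simps dependency_graph_def)
  qed
  then obtain k where k: "a = (Var i, Var k)" "(i, k) \<in> dep_rel \<alpha> e"
    using aw by (auto simp: dependency_graph_def dep_rel_def)
  have "pre_digraph.awalk (dependency_graph \<alpha> e) (Var k) p (Var j)"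
    using aw cas k(1) by (auto simp: pre_digraph.awalk_def dependency_graph_def)
  from relpow_Suc_I2[OF k(2) Cons.IH[OF this]] show ?case by simp
qed

lemma relpow_imp_dep_awalk:
  assumes "(i, j) \<in> dep_rel \<alpha> e ^^ m"
  shows "\<exists>p. pre_digraph.awalk (dependency_graph \<alpha> e) (Var i) p (Var j) \<and> length p = m"
  using assms
proof (induction m arbitrary: i)
  case 0
  then show ?case
    by (intro exI[of _ "[]"])
       (simp add: pre_digraph.awalk_def pre_digraph.cas.simps dependency_graph_def)
next
  case (Suc m)
  then obtain k where k: "(i, k) \<in> dep_rel \<alpha> e" "(k, j) \<in> dep_rel \<alpha> e ^^ m"
    by (meson relpow_Suc_E2)
  then obtain p where p: "pre_digraph.awalk (dependency_graph \<alpha> e) (Var k) p (Var j)" "length p = m"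
    using Suc.IH by blast
  then have "pre_digraph.awalk (dependency_graph \<alpha> e) (Var i) ((Var i, Var k) # p) (Var j)"
    using k(1)
    by (auto simp: pre_digraph.awalk_def pre_digraph.cas.simps dependency_graph_def dep_rel_def)
  then show ?case using p(2) by (metis length_Cons)
qed

lemma dep_walk_iff:
  "(\<exists>p. pre_digraph.awalk (dependency_graph \<alpha> e) (Var i) p (Var j) \<and> length p = m)
     \<longleftrightarrow> (i, j) \<in> dep_rel \<alpha> e ^^ m"
  using dep_awalk_imp_relpow relpow_imp_dep_awalk by metis

lemma dep_strongly_connected_iff:
  "dep_strongly_connected (dependency_graph \<alpha> e) \<longleftrightarrow> (\<forall>i j. (i, j) \<in> (dep_rel \<alpha> e)\<^sup>*)"
  unfolding dep_strongly_connected_def rtrancl_power using dep_walk_iff by metis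

lemma vertex_loop_number_dep:
  "vertex_loop_number (dependency_graph \<alpha> e) (Var i) =
     (if \<exists>m>0. (i, i) \<in> dep_rel \<alpha> e ^^ m
      then LEAST t. t \<ge> 1 \<and> closed_diff (dep_rel \<alpha> e) i t else 0)"
proof -
  have "(\<exists>p. pre_digraph.awalk (dependency_graph \<alpha> e) (Var i) p (Var i) \<and> length p > 0)
      \<longleftrightarrow> (\<exists>m>0. (i, i) \<in> dep_rel \<alpha> e ^^ m)"
    using dep_walk_iff[of \<alpha> e i i] by metis
  moreover have "(\<exists>p q. pre_digraph.awalk (dependency_graph \<alpha> e) (Var i) p (Var i)
        \<and> pre_digraph.awalk (dependency_graph \<alpha> e) (Var i) q (Var i)
        \<and> int t = int (length p) - int (length q))
      \<longleftrightarrow> closed_diff (dep_rel \<alpha> e) i t" for t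
    unfolding closed_diff_def using dep_walk_iff[of \<alpha> e i i] by metis
  ultimately show ?thesis unfolding vertex_loop_number_def by (simp only:)
qed

text \<open>Differences and positive closed walks are carried from any vertex to any other, so
  exactly one value satisfies the definite description.\<close>

lemma loop_number_eq_vertex_loop_number:
  assumes "dep_strongly_connected (dependency_graph \<alpha> e)"
  shows "loop_number (dependency_graph \<alpha> e) = vertex_loop_number (dependency_graph \<alpha> e) (Var i)"
proof -
  have conn: "(x, y) \<in> (dep_rel \<alpha> e)\<^sup>*" for x y
    using assms by (simp add: dep_strongly_connected_iff)
  have "vertex_loop_number (dependency_graph \<alpha> e) (Var j)
      = vertex_loop_number (dependency_graph \<alpha> e) (Var i)" for j
  proof -
    have "closed_diff (dep_rel \<alpha> e) j = closed_diff (dep_rel \<alpha> e) i"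
      by (intro ext iffI; erule closed_diff_transfer[OF conn conn])
    moreover have "(\<exists>m>0. (j, j) \<in> dep_rel \<alpha> e ^^ m) \<longleftrightarrow> (\<exists>m>0. (i, i) \<in> dep_rel \<alpha> e ^^ m)"
      by (intro iffI; erule positive_closed_transfer[OF conn conn])
    ultimately show ?thesis by (simp only: vertex_loop_number_dep)
  qed
  then show ?thesis unfolding loop_number_def by (intro the_equality) auto
qed

section \<open>Limit cycles\<close>

lemma monomial_map_eq_1_iff:
  assumes "\<forall>j i. e j i \<in> {0, 1}"
  shows "monomial_map \<alpha> e x $ i = 1 \<longleftrightarrow> \<alpha> i = 1 \<and> (\<forall>j. e j i = 1 \<longrightarrow> x $ j = 1)"
proof -
  have "(\<Prod>j\<in>UNIV. (x $ j) ^ e j i) \<noteq> 0 \<longleftrightarrow> (\<forall>j. e j i = 1 \<longrightarrow> x $ j \<noteq> 0)"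
  proof -
    have "(x $ j) ^ e j i \<noteq> 0 \<longleftrightarrow> (e j i = 1 \<longrightarrow> x $ j \<noteq> 0)" for j
      using assms[rule_format, of j i] by auto
    then show ?thesis by simp
  qed
  then show ?thesis by (simp add: monomial_map_def)
qed

text \<open>An edge from \<open>i\<close> to \<open>k\<close> makes the variable at \<open>k\<close>
  a factor of coordinate \<open>i\<close>, so a zero moves backwards along one edge of the walk per
  iteration.\<close>

lemma funpow_monomial_map_eq_0:
  assumes "\<forall>j i. e j i \<in> {0, 1}" "(i, j) \<in> dep_rel \<alpha> e ^^ m" "x $ j = 0"
  shows "(monomial_map \<alpha> e ^^ m) x $ i = 0"
  using assms(2)
proof (induction m arbitrary: i)
  case 0
  then show ?case using assms(3) by simp
next
  case (Suc m)
  then obtain k where k: "(i, k) \<in> dep_rel \<alpha> e" "(k, j) \<in> dep_rel \<alpha> e ^^ m"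
    by (meson relpow_Suc_E2)
  have "(monomial_map \<alpha> e ^^ m) x $ k = 0" using Suc.IH k(2) by blast
  then have "monomial_map \<alpha> e ((monomial_map \<alpha> e ^^ m) x) $ i \<noteq> 1"
    using k(1) by (auto simp: monomial_map_eq_1_iff[OF assms(1)] dep_rel_def)
  then show ?case by simp
qed

section \<open>Cycles of the state space as periodic orbits\<close>

lemma cas_state_space:
  assumes "pre_digraph.cas (state_space f) u c v" "set c \<subseteq> arcs (state_space f)"
  shows "v = (f ^^ length c) u"
  using assms
proof (induction c arbitrary: u)
  case Nil
  then show ?case by (simp add: pre_digraph.cas.simps)
next
  case (Cons a c)
  then have "v = (f ^^ length c) (f u)"
    by (auto simp: pre_digraph.cas.simps state_space_def)
  then show ?case by (simp add: funpow_swap1)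
qed

text \<open>The only arc out of a state \<open>u\<close> leads to \<open>f u\<close>. This
  translates the distinctness condition on cycles into injectivity along the orbit.\<close>

lemma awalk_verts_state_space:
  assumes "pre_digraph.cas (state_space f) u c v" "set c \<subseteq> arcs (state_space f)"
  shows "pre_digraph.awalk_verts (state_space f) u c = map (\<lambda>k. (f ^^ k) u) [0..<Suc (length c)]"
  using assms
proof (induction c arbitrary: u)
  case Nil
  then show ?case by (simp add: pre_digraph.awalk_verts.simps)
next
  case (Cons a c)
  then have a: "a = (u, f u)" and cas: "pre_digraph.cas (state_space f) (f u) c v"
    by (auto simp: pre_digraph.cas.simps state_space_def)
  have "pre_digraph.awalk_verts (state_space f) (f u) c
      = map (\<lambda>k. (f ^^ k) (f u)) [0..<Suc (length c)]"
    using Cons.IH[OF cas] Cons.prems(2) by simp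
  then have "pre_digraph.awalk_verts (state_space f) u (a # c)
      = u # map (\<lambda>k. (f ^^ k) u) (map Suc [0..<Suc (length c)])"
    using a by (simp add: pre_digraph.awalk_verts.simps state_space_def funpow_swap1)
  also have "\<dots> = map (\<lambda>k. (f ^^ k) u) [0..<Suc (length (a # c))]"
    by (simp only: map_Suc_upt upt_rec[of 0 "Suc (length (a # c))"]) simp
  finally show ?case .
qed

lemma orbit_cas:
  "pre_digraph.cas (state_space f) u (map (\<lambda>k. ((f ^^ k) u, (f ^^ Suc k) u)) [0..<d]) ((f ^^ d) u)"
proof (induction d arbitrary: u)
  case 0
  then show ?case by (simp add: pre_digraph.cas.simps)
next
  case (Suc d)
  have "map (\<lambda>k. ((f ^^ k) u, (f ^^ Suc k) u)) [0..<Suc d]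
      = (u, f u) # map (\<lambda>k. ((f ^^ k) (f u), (f ^^ Suc k) (f u))) [0..<d]"
    unfolding map_upt_Suc by (simp add: funpow_swap1)
  then show ?case
    using Suc.IH[of "f u"]
    by (simp add: pre_digraph.cas.simps state_space_def funpow_swap1)
qed

text \<open>The indices run over \<open>{1..d}\<close> and not from \<open>0\<close>, because a
  cycle requires distinctness of its vertex list without the first entry.\<close>

lemma limit_cycle_of_orbit:
  assumes "d > 0" "(f ^^ d) u = u" "inj_on (\<lambda>k. (f ^^ k) u) {1..d}"
  shows "\<exists>c. limit_cycle f c \<and> length c = d"
proof -
  define c where "c = map (\<lambda>k. ((f ^^ k) u, (f ^^ Suc k) u)) [0..<d]"
  have cas: "pre_digraph.cas (state_space f) u c u"
    using orbit_cas[of f u d] assms(2) by (simp add: c_def)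
  have arcs: "set c \<subseteq> arcs (state_space f)"
    by (auto simp: c_def state_space_def)
  have len: "length c = d" by (simp add: c_def)
  have "{Suc 0..<Suc d} = {1..d}" by auto
  then have "distinct (tl (pre_digraph.awalk_verts (state_space f) u c))"
    unfolding awalk_verts_state_space[OF cas arcs] len
    using assms(3) by (simp add: map_tl[symmetric] tl_upt distinct_map del: upt_Suc)
  moreover have "c \<noteq> []" using len assms(1) by auto
  ultimately have "limit_cycle f c"
    unfolding limit_cycle_def pre_digraph.cycle_def pre_digraph.awalk_def
    using cas arcs by (intro exI[of _ u]) (simp add: state_space_def)
  then show ?thesis using len by blast
qed

lemma limit_cycle_periodic:
  assumes "limit_cycle f c"
  obtains u where "(f ^^ length c) u = u" "length c > 0"
    "inj_on (\<lambda>k. (f ^^ k) u) {1..length c}"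
proof -
  obtain u where cas: "pre_digraph.cas (state_space f) u c u"
    and arcs: "set c \<subseteq> arcs (state_space f)"
    and dist: "distinct (tl (pre_digraph.awalk_verts (state_space f) u c))" and ne: "c \<noteq> []"
    using assms unfolding limit_cycle_def pre_digraph.cycle_def pre_digraph.awalk_def by blast
  have "{Suc 0..<Suc (length c)} = {1..length c}" by auto
  then have "inj_on (\<lambda>k. (f ^^ k) u) {1..length c}"
    using dist unfolding awalk_verts_state_space[OF cas arcs]
    by (simp add: map_tl[symmetric] tl_upt distinct_map del: upt_Suc)
  then show ?thesis using that[of u] cas_state_space[OF cas arcs] ne by auto
qed

lemma limit_cycle_fixed_point:
  assumes "limit_cycle f c" and fixed: "\<And>u. (f ^^ length c) u = u \<Longrightarrow> f u = u"
  shows "length c = 1"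
proof -
  obtain u where u: "(f ^^ length c) u = u" "length c > 0"
    "inj_on (\<lambda>k. (f ^^ k) u) {1..length c}"
    using limit_cycle_periodic[OF assms(1)] .
  have "(f ^^ k) u = u" for k
    using fixed[OF u(1)] by (induction k) simp_all
  \<comment> \<open>The orbit is constant, so injectivity identifies the first and the last
    index.\<close>
  then have "1 = length c"
    using u(2) by (intro inj_onD[OF u(3)]) (simp_all only: \<open>\<And>k. (f ^^ k) u = u\<close> atLeastAtMost_iff, linarith+)
  then show ?thesis by simp
qed

section \<open>Periodic states under strong connectedness\<close>

lemma monomial_map_limit_cycle:
  fixes \<alpha> :: "'n :: finite \<Rightarrow> bit"
  assumes e01: "\<forall>j i. e j i \<in> {0, 1}"
    and \<alpha>: "\<And>i. \<alpha> i = 1"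
    and conn: "\<And>x y. (x, y) \<in> (dep_rel \<alpha> e)\<^sup>*"
    and succ: "\<And>i. \<exists>j. (i, j) \<in> dep_rel \<alpha> e"
    and closed: "\<And>m. (a, a) \<in> dep_rel \<alpha> e ^^ m \<Longrightarrow> d dvd m"
    and "d > 0"
  shows "\<exists>c. limit_cycle (monomial_map \<alpha> e) c \<and> length c = d"
proof -
  let ?R = "dep_rel \<alpha> e" and ?f = "monomial_map \<alpha> e"
  \<comment> \<open>\<open>h i\<close> is the length of some walk from \<open>a\<close> to
    \<open>i\<close>; the choice is arbitrary, but its residue modulo \<open>d\<close> is not, and
    this residue is the class of \<open>i\<close>.\<close>
  obtain h where h: "\<And>i. (a, i) \<in> ?R ^^ h i"
    using conn unfolding rtrancl_power by metis
  have h_mod: "h i mod d = m mod d" if "(a, i) \<in> ?R ^^ m" for i m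
    using walk_length_cong[OF conn closed h that] .
  have h_succ: "d dvd h j + k \<longleftrightarrow> d dvd h i + Suc k" if "(i, j) \<in> ?R" for i j k
  proof -
    have "h j mod d = Suc (h i) mod d"
      using h_mod[OF relpow_Suc_I[OF h that]] .
    then have "(h j + k) mod d = (Suc (h i) + k) mod d"
      by (metis mod_add_left_eq)
    then show ?thesis by (simp add: dvd_eq_mod_eq_0)
  qed
  \<comment> \<open>The indicator of the class of \<open>a\<close>. Each iteration moves it one
    class back, so the \<open>k\<close>-th iterate indicates the class of \<open>-k\<close>.\<close>
  define x :: "bit ^ 'n" where "x = (\<chi> i. if d dvd h i then 1 else 0)"
  have iter: "(?f ^^ k) x $ i = 1 \<longleftrightarrow> d dvd h i + k" for k i
  proof (induction k arbitrary: i)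
    case 0
    then show ?case by (simp add: x_def)
  next
    case (Suc k)
    have "(?f ^^ Suc k) x $ i = 1 \<longleftrightarrow> (\<forall>j. (i, j) \<in> ?R \<longrightarrow> (?f ^^ k) x $ j = 1)"
      using \<alpha> by (simp add: monomial_map_eq_1_iff[OF e01] dep_rel_def)
    \<comment> \<open>All successors of \<open>i\<close> lie in the same class and at least one
      exists, so the conjunction over them reduces to a single divisibility.\<close>
    also have "\<dots> \<longleftrightarrow> d dvd h i + Suc k"
      using Suc.IH h_succ succ[of i] by blast
    finally show ?case .
  qed
  have "(?f ^^ d) x $ i = x $ i" for i
  proof -
    have "(?f ^^ d) x $ i = 1 \<longleftrightarrow> x $ i = 1"
      using iter[of d i] iter[of 0 i] by simp
    then show ?thesis by (metis bit_not_one_iff)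
  qed
  then have periodic: "(?f ^^ d) x = x" by (simp add: vec_eq_iff)
  \<comment> \<open>Walks of every length start at \<open>a\<close>, so no residue class is empty
    and the iterates can be told apart.\<close>
  have walks: "\<exists>i. (a, i) \<in> ?R ^^ m" for m
  proof (induction m)
    case (Suc m)
    then show ?case using succ relpow_Suc_I by metis
  qed simp
  have "(?f ^^ k) x \<noteq> (?f ^^ l) x" if "1 \<le> k" "k < l" "l \<le> d" for k l
  proof
    assume eq: "(?f ^^ k) x = (?f ^^ l) x"
    \<comment> \<open>At a vertex of class \<open>d - k\<close> the \<open>k\<close>-th iterate is
      1. If the \<open>l\<close>-th were 1 there too, \<open>d\<close> would divide
      \<open>l - k\<close>, which lies strictly between 0 and \<open>d\<close>.\<close>
    obtain i where "(a, i) \<in> ?R ^^ (d - k)" using walks by blast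
    then have "(h i + k) mod d = (d - k + k) mod d"
      using h_mod by (metis mod_add_left_eq)
    then have k: "d dvd h i + k"
      using that by (simp add: dvd_eq_mod_eq_0)
    then have "d dvd h i + l"
      using eq iter by metis
    then have "d dvd (h i + l) - (h i + k)"
      using k by (rule dvd_diff_nat)
    then show False
      using that by (auto dest: dvd_imp_le)
  qed
  then have "inj_on (\<lambda>k. (?f ^^ k) x) {1..d}"
    by (intro linorder_inj_onI) auto
  from limit_cycle_of_orbit[OF \<open>d > 0\<close> periodic this] show ?thesis .
qed

lemma monomial_map_fixes_0:
  assumes "\<forall>j i. e j i \<in> {0, 1}" "\<And>i. \<exists>j. (i, j) \<in> dep_rel \<alpha> e"
  shows "monomial_map \<alpha> e (\<chi> i. 0) = (\<chi> i. 0)"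
proof -
  have "monomial_map \<alpha> e (\<chi> i. 0) $ i \<noteq> 1" for i
    using assms(2)[of i] by (auto simp: monomial_map_eq_1_iff[OF assms(1)] dep_rel_def)
  then show ?thesis by (simp add: vec_eq_iff)
qed

lemma monomial_map_fixes_1:
  assumes "\<forall>j i. e j i \<in> {0, 1}" "\<And>i. \<alpha> i = 1"
  shows "monomial_map \<alpha> e (\<chi> i. 1) = (\<chi> i. 1)"
  using assms by (simp add: vec_eq_iff monomial_map_eq_1_iff)

lemma monomial_map_periodic_constant:
  assumes e01: "\<forall>j i. e j i \<in> {0, 1}"
    and conn: "\<And>x y. (x, y) \<in> (dep_rel \<alpha> e)\<^sup>*"
    and loop: "\<And>i. closed_diff (dep_rel \<alpha> e) i 1"
    and periodic: "(monomial_map \<alpha> e ^^ s) u = u" "s > 0"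
  shows "u = (\<chi> i. 0) \<or> u = (\<chi> i. 1)"
proof (rule disjCI)
  assume "u \<noteq> (\<chi> i. 1)"
  then obtain j where j: "u $ j = 0" by (auto simp: vec_eq_iff)
  obtain N where N: "\<And>n. n \<ge> N \<Longrightarrow> (j, j) \<in> dep_rel \<alpha> e ^^ n"
    using all_large_closed_walks[OF loop[of j]] by blast
  have "u $ i = 0" for i
  proof -
    obtain l where l: "(i, j) \<in> dep_rel \<alpha> e ^^ l"
      using conn by (auto simp: rtrancl_power)
    \<comment> \<open>The length \<open>(l + N) * s\<close> is a multiple of the period, so that
      iterate is \<open>u\<close> again; it also leaves at least \<open>N\<close> steps at
      \<open>j\<close> after the walk of length \<open>l\<close>.\<close>
    have le: "l + N \<le> (l + N) * s" using periodic(2) by simp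
    then have "N \<le> (l + N) * s - l" by linarith
    then have "(i, j) \<in> dep_rel \<alpha> e ^^ (l + ((l + N) * s - l))"
      using relpow_relpow_add[OF l N] by blast
    then have "(i, j) \<in> dep_rel \<alpha> e ^^ ((l + N) * s)" using le by simp
    then have "(monomial_map \<alpha> e ^^ ((l + N) * s)) u $ i = 0"
      using funpow_monomial_map_eq_0[OF e01] j by blast
    moreover have "(monomial_map \<alpha> e ^^ (k * s)) u = u" for k
      using periodic(1) by (induction k) (auto simp: funpow_add)
    ultimately show ?thesis by simp
  qed
  then show "u = (\<chi> i. 0)" by (simp add: vec_eq_iff)
qed

theorem corollary4p12:
  fixes f :: "bit ^ 'n \<Rightarrow> bit ^ ('n :: finite)"
    and \<alpha> :: "'n \<Rightarrow> bit"
    and e :: "'n \<Rightarrow> 'n \<Rightarrow> nat"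
    and t :: nat
  assumes "boolean_monomial_system f \<alpha> e"
    and "dep_strongly_connected (dependency_graph \<alpha> e)"
    and "loop_number (dependency_graph \<alpha> e) = t"
    and "t \<ge> 1"
  shows "(f (\<chi> i. 0) = (\<chi> i. 0) \<and> f (\<chi> i. 1) = (\<chi> i. 1)) \<and>
    (\<forall>d. d dvd t \<longrightarrow> (\<exists>c. limit_cycle f c \<and> length c = d)) \<and>
    (fixed_point_system f \<longleftrightarrow> loop_number (dependency_graph \<alpha> e) = 1)"
proof -
  let ?R = "dep_rel \<alpha> e"
  have e01: "\<forall>j i. e j i \<in> {0, 1}" and f: "f = monomial_map \<alpha> e"
    using assms(1) unfolding boolean_monomial_system_def by blast+
  have conn: "(x, y) \<in> ?R\<^sup>*" for x y
    using assms(2) by (simp add: dep_strongly_connected_iff)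
  have t: "t = (if \<exists>m>0. (i, i) \<in> ?R ^^ m then LEAST s. s \<ge> 1 \<and> closed_diff ?R i s else 0)" for i
    using loop_number_eq_vertex_loop_number[OF assms(2)] vertex_loop_number_dep assms(3) by metis
  \<comment> \<open>The default value 0 is excluded by \<open>t \<ge> 1\<close>.\<close>
  have pos: "\<exists>m>0. (i, i) \<in> ?R ^^ m" for i
    using t[of i] assms(4) by (metis not_one_le_zero)
  have t_least: "t = (LEAST s. s \<ge> 1 \<and> closed_diff ?R i s)" for i
    using t[of i] pos[of i] by simp
  \<comment> \<open>Subtracting the empty walk turns the length of any positive closed walk into a
    difference, so the minimum is taken over a nonempty set.\<close>
  have diff: "closed_diff ?R i t" for i
  proof -
    obtain m where m: "m > 0" "(i, i) \<in> ?R ^^ m" using pos by blast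
    moreover have "(i, i) \<in> ?R ^^ 0" by simp
    moreover have "int m = int m - int 0" by simp
    ultimately have "m \<ge> 1 \<and> closed_diff ?R i m"
      unfolding closed_diff_def by (metis One_nat_def Suc_leI)
    then have "(LEAST s. s \<ge> 1 \<and> closed_diff ?R i s) \<ge> 1
        \<and> closed_diff ?R i (LEAST s. s \<ge> 1 \<and> closed_diff ?R i s)"
      by (rule LeastI)
    then show ?thesis using t_least[of i] by simp
  qed
  have least: "t \<le> s" if "closed_diff ?R i s" "s \<ge> 1" for i s
    using t_least[of i] that by (simp add: Least_le)
  \<comment> \<open>The first edge of a closed walk leaves \<open>i\<close>; hence every coordinate
    of \<open>f\<close> contains a variable and none is constant.\<close>
  have succ: "\<exists>j. (i, j) \<in> ?R" for i
    using pos[of i] by (metis gr0_implies_Suc relpow_Suc_D2)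
  then have \<alpha>: "\<alpha> i = 1" for i
    by (auto simp: dep_rel_def)
  have fixed: "f (\<chi> i. 0) = (\<chi> i. 0)" "f (\<chi> i. 1) = (\<chi> i. 1)"
    unfolding f using monomial_map_fixes_0[OF e01 succ] monomial_map_fixes_1[OF e01 \<alpha>] by simp_all
  have cycles: "\<exists>c. limit_cycle f c \<and> length c = d" if "d dvd t" for d
    unfolding f
  proof (rule monomial_map_limit_cycle[OF e01 \<alpha> conn succ])
    show "d dvd m" if "(i, i) \<in> ?R ^^ m" for i m
      using least_closed_diff_dvd[OF diff assms(4) least that] \<open>d dvd t\<close> by (rule dvd_trans[rotated])
    show "d > 0" using that assms(4) by (auto intro: Nat.gr0I)
  qed
  have "fixed_point_system f \<longleftrightarrow> t = 1"
  proof
    assume "fixed_point_system f"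
    \<comment> \<open>There is a limit cycle of length \<open>t\<close> itself.\<close>
    then show "t = 1" using cycles[of t] by (auto simp: fixed_point_system_def)
  next
    assume "t = 1"
    have "length c = 1" if "limit_cycle f c" for c
    proof (rule limit_cycle_fixed_point[OF that])
      fix u assume u: "(f ^^ length c) u = u"
      have "length c > 0" using limit_cycle_periodic[OF that] by metis
      then have "u = (\<chi> i. 0) \<or> u = (\<chi> i. 1)"
        using monomial_map_periodic_constant[OF e01 conn _ u[unfolded f]] diff \<open>t = 1\<close> by simp
      then show "f u = u" using fixed by auto
    qed
    then show "fixed_point_system f" by (simp add: fixed_point_system_def)
  qed
  then show ?thesis using fixed cycles assms(3) by simp
qed

end
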